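(* Suppose $\mathcal{G}$ is a canonical DAG over main variables $\bm{V}=\{V_1,\dots,V_J\}$ and disturbances $\bm{U}=\{U_1,\dots,U_K\}$, where the disturbances take values in finite sets $\mathcal{S}(U_1),\dots,\mathcal{S}(U_K)$. Let $\mathcal{P}_{\bm{V}}$ denote the full data law and let $g(\mathcal{P}_{\bm{V}})$ be a functional of $\mathcal{P}_{\bm{V}}$ involving elementary arithmetic operations (addition, subtraction, multiplication, division) on constants and marginal probabilities of $\mathcal{P}_{\bm{V}}$. Then $g(\mathcal{P}_{\bm{V}})$ can be expressed as a polynomial fraction (ratio of polynomials) $h(\mathcal{P}_{\bm{U}})$ in the parameters $\mathcal{P}_{\bm{U}}=\{\Pr(U_k=u_k): k,\ u_k\in\mathcal{S}(U_k)\}$, by replacing each marginal probability $\Pr\big(\bigwedge_\ell \{V_\ell(\bm{a}_\ell)=v_\ell\}\big)$ appearing in $g$ with the polynomial $$\sum_{\bm{u}\in\mathcal{U}}\ \prod_{k}\Pr(U_k=u_k),$$ where $\mathcal{U}\subseteq\prod_k\mathcal{S}(U_k)$ is the set of disturbance realizations for which every statement $V_\ell(\bm{a}_\ell)=v_\ell$ holds.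
   Context: $\mathcal{G}$ is a directed acyclic graph on $\bm{V}\cup\bm{U}$; $\bm{pa}(X)$ denotes the parents of $X$ in $\mathcal{G}$. Main variables take values in finite sets. $\mathcal{G}$ is canonical if (i) no disturbance has a parent in $\mathcal{G}$, and (ii) there is no pair of distinct disturbances $U,U'$ such that the set of children of $U$ is a subset of the set of children of $U'$. Under the structural equation model, the disturbances are mutually independent, and each main variable is a fixed deterministic function $V_j=f_j(\bm{pa}(V_j))$ of its parents. Potential outcomes: for $\bm{A}\subseteq\bm{V}$ and values $\bm{a}$ of $\bm{A}$, $V_j(\bm{a})$ is defined recursively as $f_j$ evaluated with each main parent of $V_j$ in $\bm{A}$ set to its value in $\bm{a}$, each main parent $V_{j'}\notin\bm{A}$ set to $V_{j'}(\bm{a})$, and disturbances at their realized values. Intervention on $V_j$ itself is ignored in $V_j(\bm{a})$; $V_j(\varnothing)=V_j$. The full data law $\mathcal{P}_{\bm{V}}$ is the joint distribution of all $V_j(\bm{a})$ over all $j$, all $\bm{A}\subseteq\bm{V}$ and all values $\bm{a}$. A marginal probability of $\mathcal{P}_{\bm{V}}$ is a probability of the form $\Pr\big(\bigwedge_\ell\{V_\ell(\bm{a}_\ell)=v_\ell\}\big)$ for a finite collection of counterfactual statements (possibly with different interventions). The equality $g(\mathcal{P}_{\bm{V}})=h(\mathcal{P}_{\bm{U}})$ is understood wherever $g$ is defined (no division by zero). *)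

theory Defs
  imports "HOL-Probability.Probability" "HOL-Library.Poly_Mapping"
begin

section \<open>Canonical directed acyclic graphs\<close>

text \<open>An edge \<open>(x, y) \<in> E\<close> points from \<open>x\<close> to \<open>y\<close>. Main variables \<open>V\<close> and disturbances \<open>U\<close> are
  disjoint sets of nodes of the same type.\<close>

definition parents :: "'n rel \<Rightarrow> 'n \<Rightarrow> 'n set" where
  "parents E x = {y. (y, x) \<in> E}"

definition children :: "'n rel \<Rightarrow> 'n \<Rightarrow> 'n set" where
  "children E x = {y. (x, y) \<in> E}"

definition dag_on :: "'n set \<Rightarrow> 'n set \<Rightarrow> 'n rel \<Rightarrow> bool" where
  "dag_on V U E \<longleftrightarrow>
     finite V \<and> finite U \<and> V \<inter> U = {} \<and> E \<subseteq> (V \<union> U) \<times> (V \<union> U) \<and> acyclic E"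

definition canonical_dag :: "'n set \<Rightarrow> 'n set \<Rightarrow> 'n rel \<Rightarrow> bool" where
  "canonical_dag V U E \<longleftrightarrow>
     dag_on V U E \<and>
     (\<forall>u\<in>U. parents E u = {}) \<and>
     \<not> (\<exists>u\<in>U. \<exists>u'\<in>U. u \<noteq> u' \<and> children E u \<subseteq> children E u')"


section \<open>Structural equations and potential outcomes\<close>

text \<open>\<open>S x\<close> is the finite set of values of the node \<open>x\<close>. The structural function \<open>f j\<close> takes an
  assignment of values to exactly the parents of \<open>j\<close>.\<close>

definition structural_equations ::
  "'n set \<Rightarrow> 'n set \<Rightarrow> 'n rel \<Rightarrow> ('n \<Rightarrow> 'a set) \<Rightarrow> ('n \<Rightarrow> ('n \<Rightarrow> 'a) \<Rightarrow> 'a) \<Rightarrow> bool" where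
  "structural_equations V U E S f \<longleftrightarrow>
     (\<forall>x\<in>V \<union> U. finite (S x)) \<and>
     (\<forall>j\<in>V. f j \<in> (\<Pi>\<^sub>E p\<in>parents E j. S p) \<rightarrow> S j)"

text \<open>An intervention, setting a set \<open>A \<subseteq> V\<close> of main variables to values, is a partial map
  with domain \<open>A\<close>.\<close>

definition interventions :: "'n set \<Rightarrow> ('n \<Rightarrow> 'a set) \<Rightarrow> ('n \<Rightarrow> 'a option) set" where
  "interventions V S = {a. dom a \<subseteq> V \<and> (\<forall>x y. a x = Some y \<longrightarrow> y \<in> S x)}"

text \<open>\<open>potential_outcome V E f u a j\<close> is the value of \<open>V\<^sub>j(a)\<close> at the realization \<open>u\<close> of the
  disturbances, by recursion along the edges of the graph. The value of \<open>a\<close> at \<open>j\<close> itself is not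
  used. The recursion equation is the lemma below.\<close>

definition potential_outcome ::
  "'n set \<Rightarrow> 'n rel \<Rightarrow> ('n \<Rightarrow> ('n \<Rightarrow> 'a) \<Rightarrow> 'a) \<Rightarrow> ('n \<Rightarrow> 'a) \<Rightarrow> ('n \<Rightarrow> 'a option) \<Rightarrow> 'n \<Rightarrow> 'a" where
  "potential_outcome V E f u a =
     wfrec E (\<lambda>outcome j. f j (\<lambda>p\<in>parents E j.
       case a p of
         Some y \<Rightarrow> y
       | None \<Rightarrow> (if p \<in> V then outcome p else u p)))"

lemma dag_on_wf:
  assumes "dag_on V U E"
  shows "wf E"
proof -
  have "finite ((V \<union> U) \<times> (V \<union> U))"
    using assms by (auto simp: dag_on_def)
  then have "finite E"
    using assms by (auto simp: dag_on_def intro: finite_subset)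
  then show ?thesis
    using assms by (auto simp: dag_on_def intro: finite_acyclic_wf)
qed

lemma potential_outcome_rec:
  assumes "dag_on V U E"
  shows "potential_outcome V E f u a j =
    f j (\<lambda>p\<in>parents E j.
      case a p of
        Some y \<Rightarrow> y
      | None \<Rightarrow> (if p \<in> V then potential_outcome V E f u a p else u p))"
proof -
  note wf = dag_on_wf[OF assms]
  show ?thesis
    unfolding potential_outcome_def
    by (subst wfrec[OF wf])
       (intro arg_cong[of _ _ "f j"] restrict_ext,
        auto simp: parents_def cut_apply split: option.splits)
qed


section \<open>The full data law\<close>

text \<open>The disturbances are mutually independent random variables \<open>X k\<close> with values in \<open>S k\<close>
  (measurability into \<open>count_space (S k)\<close> includes \<open>X k \<omega> \<in> S k\<close> on the whole sample space).\<close>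

definition disturbance_variables ::
  "'n set \<Rightarrow> ('n \<Rightarrow> 'a set) \<Rightarrow> 'w measure \<Rightarrow> ('n \<Rightarrow> 'w \<Rightarrow> 'a) \<Rightarrow> bool" where
  "disturbance_variables U S M X \<longleftrightarrow>
     prob_space M \<and> prob_space.indep_vars M (\<lambda>k. count_space (S k)) X U"

text \<open>The parameters \<open>Pr(U\<^sub>k = u\<^sub>k)\<close>, indexed by pairs \<open>(k, u\<^sub>k)\<close>.\<close>

definition disturbance_law :: "'w measure \<Rightarrow> ('n \<Rightarrow> 'w \<Rightarrow> 'a) \<Rightarrow> 'n \<times> 'a \<Rightarrow> real" where
  "disturbance_law M X = (\<lambda>(k, y). measure M {\<omega> \<in> space M. X k \<omega> = y})"

definition full_data_law ::
  "'n set \<Rightarrow> 'n rel \<Rightarrow> ('n \<Rightarrow> 'a set) \<Rightarrow> ('n \<Rightarrow> ('n \<Rightarrow> 'a) \<Rightarrow> 'a) \<Rightarrow> 'w measure \<Rightarrow> ('n \<Rightarrow> 'w \<Rightarrow> 'a) \<Rightarrow>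
   ('n \<times> ('n \<Rightarrow> 'a option) \<Rightarrow> 'a) measure" where
  "full_data_law V E S f M X =
     distr M (\<Pi>\<^sub>M (j, a)\<in>V \<times> interventions V S. count_space (S j))
       (\<lambda>\<omega>. \<lambda>(j, a)\<in>V \<times> interventions V S. potential_outcome V E f (\<lambda>k. X k \<omega>) a j)"

text \<open>A counterfactual statement \<open>V\<^sub>j(a) = v\<close> is a triple \<open>(j, a, v)\<close>, and a finite set of
  statements stands for their conjunction.\<close>

type_synonym ('n, 'a) statements = "('n \<times> ('n \<Rightarrow> 'a option) \<times> 'a) set"

definition counterfactual_conjunctions ::
  "'n set \<Rightarrow> ('n \<Rightarrow> 'a set) \<Rightarrow> ('n, 'a) statements set" where
  "counterfactual_conjunctions V S =
     {C. finite C \<and> (\<forall>(j, a, v)\<in>C. j \<in> V \<and> a \<in> interventions V S \<and> v \<in> S j)}"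

definition marginal_prob ::
  "('n \<times> ('n \<Rightarrow> 'a option) \<Rightarrow> 'a) measure \<Rightarrow> ('n, 'a) statements \<Rightarrow> real" where
  "marginal_prob P C = measure P {y \<in> space P. \<forall>(j, a, v)\<in>C. y (j, a) = v}"


section \<open>Arithmetic expressions\<close>

text \<open>Expressions in the four elementary operations over real constants and atoms of type \<open>'x\<close>.
  For a functional of the full data law, the atoms name marginal probabilities. The generated
  function \<open>map_arith\<close> replaces the atoms of an expression.\<close>

datatype (set_arith: 'x) arith =
    Constant real
  | Atom 'x
  | Add "'x arith" "'x arith"
  | Subtract "'x arith" "'x arith"
  | Multiply "'x arith" "'x arith"
  | Divide "'x arith" "'x arith"
  for map: map_arith

primrec arith_value :: "('x \<Rightarrow> real) \<Rightarrow> 'x arith \<Rightarrow> real" where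
  "arith_value \<rho> (Constant c) = c"
| "arith_value \<rho> (Atom x) = \<rho> x"
| "arith_value \<rho> (Add s t) = arith_value \<rho> s + arith_value \<rho> t"
| "arith_value \<rho> (Subtract s t) = arith_value \<rho> s - arith_value \<rho> t"
| "arith_value \<rho> (Multiply s t) = arith_value \<rho> s * arith_value \<rho> t"
| "arith_value \<rho> (Divide s t) = arith_value \<rho> s / arith_value \<rho> t"

text \<open>No division by zero occurs in the evaluation.\<close>

primrec arith_defined :: "('x \<Rightarrow> real) \<Rightarrow> 'x arith \<Rightarrow> bool" where
  "arith_defined \<rho> (Constant c) \<longleftrightarrow> True"
| "arith_defined \<rho> (Atom x) \<longleftrightarrow> True"
| "arith_defined \<rho> (Add s t) \<longleftrightarrow> arith_defined \<rho> s \<and> arith_defined \<rho> t"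
| "arith_defined \<rho> (Subtract s t) \<longleftrightarrow> arith_defined \<rho> s \<and> arith_defined \<rho> t"
| "arith_defined \<rho> (Multiply s t) \<longleftrightarrow> arith_defined \<rho> s \<and> arith_defined \<rho> t"
| "arith_defined \<rho> (Divide s t) \<longleftrightarrow>
     arith_defined \<rho> s \<and> arith_defined \<rho> t \<and> arith_value \<rho> t \<noteq> 0"


section \<open>Polynomials in the disturbance parameters\<close>

text \<open>Multivariate polynomials with real coefficients and variables indexed by \<open>'i\<close>: finitely
  supported maps from monomials (exponent vectors) to coefficients, with the convolution product.\<close>

type_synonym 'i real_mpoly = "('i \<Rightarrow>\<^sub>0 nat) \<Rightarrow>\<^sub>0 real"

definition mpoly_var :: "'i \<Rightarrow> 'i real_mpoly" where
  "mpoly_var i = Poly_Mapping.single (Poly_Mapping.single i 1) 1"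

definition mpoly_vars :: "'i real_mpoly \<Rightarrow> 'i set" where
  "mpoly_vars p = (\<Union>m\<in>Poly_Mapping.keys p. Poly_Mapping.keys m)"

definition mpoly_value :: "('i \<Rightarrow> real) \<Rightarrow> 'i real_mpoly \<Rightarrow> real" where
  "mpoly_value \<theta> p =
     (\<Sum>m\<in>Poly_Mapping.keys p. Poly_Mapping.lookup p m *
       (\<Prod>i\<in>Poly_Mapping.keys m. \<theta> i ^ Poly_Mapping.lookup m i))"

definition satisfying_realizations ::
  "'n set \<Rightarrow> 'n set \<Rightarrow> 'n rel \<Rightarrow> ('n \<Rightarrow> 'a set) \<Rightarrow> ('n \<Rightarrow> ('n \<Rightarrow> 'a) \<Rightarrow> 'a) \<Rightarrow>
   ('n, 'a) statements \<Rightarrow> ('n \<Rightarrow> 'a) set" where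
  "satisfying_realizations V U E S f C =
     {u \<in> \<Pi>\<^sub>E k\<in>U. S k. \<forall>(j, a, v)\<in>C. potential_outcome V E f u a j = v}"

definition marginal_polynomial ::
  "'n set \<Rightarrow> 'n set \<Rightarrow> 'n rel \<Rightarrow> ('n \<Rightarrow> 'a set) \<Rightarrow> ('n \<Rightarrow> ('n \<Rightarrow> 'a) \<Rightarrow> 'a) \<Rightarrow>
   ('n, 'a) statements \<Rightarrow> ('n \<times> 'a) real_mpoly" where
  "marginal_polynomial V U E S f C =
     (\<Sum>u\<in>satisfying_realizations V U E S f C. \<Prod>k\<in>U. mpoly_var (k, u k))"

end

theory Submission
  imports Defs
begin

text \<open>Fixing the disturbances \<open>u\<close> determines every potential outcome, so a conjunction of counterfactual
  statements is the event that the disturbances fall into the finite set of satisfying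
  realizations; by independence its probability is the value of the marginal polynomial. An
  arithmetic expression in polynomials is then brought over a common denominator. This can produce
  the zero polynomial as denominator only if the expression is nowhere defined, and in that case the
  denominator is replaced by 1.\<close>

section \<open>Evaluation of multivariate polynomials\<close>

lemma mpoly_value_single:
  "mpoly_value \<theta> (Poly_Mapping.single m c) =
     c * (\<Prod>i\<in>Poly_Mapping.keys m. \<theta> i ^ Poly_Mapping.lookup m i)"
  by (simp add: mpoly_value_def)

lemma mpoly_value_zero [simp]: "mpoly_value \<theta> 0 = 0"
  by (simp add: mpoly_value_def)

lemma mpoly_value_one [simp]: "mpoly_value \<theta> 1 = 1"
  by (simp add: mpoly_value_def)

lemma mpoly_value_var [simp]: "mpoly_value \<theta> (mpoly_var i) = \<theta> i"
  by (simp add: mpoly_var_def mpoly_value_single)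

text \<open>Coefficients may cancel in \<open>p + q\<close>, so the supports need not match. The sum
  still splits because each term is additive in its coefficient and vanishes when the coefficient is
  0.\<close>

lemma mpoly_value_add [simp]: "mpoly_value \<theta> (p + q) = mpoly_value \<theta> p + mpoly_value \<theta> q"
  unfolding mpoly_value_def by (rule setsum_keys_plus_distrib) (auto simp: algebra_simps)

lemma mpoly_value_diff [simp]: "mpoly_value \<theta> (p - q) = mpoly_value \<theta> p - mpoly_value \<theta> q"
  using mpoly_value_add[of \<theta> "p - q" q] by simp

lemma mpoly_value_sum [simp]: "mpoly_value \<theta> (sum p A) = (\<Sum>x\<in>A. mpoly_value \<theta> (p x))"
  by (induction A rule: infinite_finite_induct) auto

text \<open>Extending all three products to the union of the two supports only adds factors with
  exponent 0, and there the power law applies factor by factor.\<close>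

lemma prod_keys_add:
  fixes m n :: "'i \<Rightarrow>\<^sub>0 nat" and \<theta> :: "'i \<Rightarrow> real"
  shows "(\<Prod>i\<in>Poly_Mapping.keys (m + n). \<theta> i ^ Poly_Mapping.lookup (m + n) i) =
    (\<Prod>i\<in>Poly_Mapping.keys m. \<theta> i ^ Poly_Mapping.lookup m i) *
    (\<Prod>i\<in>Poly_Mapping.keys n. \<theta> i ^ Poly_Mapping.lookup n i)"
proof -
  let ?K = "Poly_Mapping.keys m \<union> Poly_Mapping.keys n"
  have extend: "(\<Prod>i\<in>Poly_Mapping.keys l. \<theta> i ^ Poly_Mapping.lookup l i) =
      (\<Prod>i\<in>?K. \<theta> i ^ Poly_Mapping.lookup l i)" if "Poly_Mapping.keys l \<subseteq> ?K" for l :: "'i \<Rightarrow>\<^sub>0 nat"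
    using that by (intro prod.mono_neutral_left) (auto simp: in_keys_iff)
  show ?thesis
    unfolding extend[OF keys_add] extend[OF Un_upper1] extend[OF Un_upper2]
    by (simp add: lookup_add power_add prod.distrib)
qed

text \<open>Reduces multiplicativity of evaluation to products of single monomials.\<close>

lemma mpoly_as_sum_of_monomials:
  fixes p :: "'i real_mpoly"
  shows "p = (\<Sum>m\<in>Poly_Mapping.keys p. Poly_Mapping.single m (Poly_Mapping.lookup p m))"
  by (rule poly_mapping_eqI) (auto simp: lookup_sum lookup_single when_def in_keys_iff)

lemma mpoly_value_mult [simp]: "mpoly_value \<theta> (p * q) = mpoly_value \<theta> p * mpoly_value \<theta> q"
proof -
  have "mpoly_value \<theta> (p * q) = mpoly_value \<theta>
      ((\<Sum>m\<in>Poly_Mapping.keys p. Poly_Mapping.single m (Poly_Mapping.lookup p m)) *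
       (\<Sum>n\<in>Poly_Mapping.keys q. Poly_Mapping.single n (Poly_Mapping.lookup q n)))"
    using mpoly_as_sum_of_monomials[of p] mpoly_as_sum_of_monomials[of q] by simp
  also have "\<dots> = mpoly_value \<theta> p * mpoly_value \<theta> q"
    unfolding sum_product mpoly_value_sum mult_single mpoly_value_single prod_keys_add
    by (simp add: mpoly_value_def sum_product mult_ac)
  finally show ?thesis .
qed

lemma mpoly_value_prod [simp]: "mpoly_value \<theta> (prod p A) = (\<Prod>x\<in>A. mpoly_value \<theta> (p x))"
  by (induction A rule: infinite_finite_induct) auto

section \<open>Variables occurring in sums and products of polynomials\<close>

lemma mpoly_vars_zero [simp]: "mpoly_vars 0 = {}"
  by (simp add: mpoly_vars_def)

lemma mpoly_vars_one [simp]: "mpoly_vars 1 = {}"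
  by (simp add: mpoly_vars_def)

lemma mpoly_vars_var [simp]: "mpoly_vars (mpoly_var i) = {i}"
  by (simp add: mpoly_vars_def mpoly_var_def)

lemma mpoly_vars_add: "mpoly_vars (p + q) \<subseteq> mpoly_vars p \<union> mpoly_vars q"
  using keys_add[of p q] by (auto simp: mpoly_vars_def)

lemma mpoly_vars_diff: "mpoly_vars (p - q) \<subseteq> mpoly_vars p \<union> mpoly_vars q"
  using keys_diff[of p q] by (auto simp: mpoly_vars_def)

lemma mpoly_vars_mult: "mpoly_vars (p * q) \<subseteq> mpoly_vars p \<union> mpoly_vars q"
proof
  fix i assume "i \<in> mpoly_vars (p * q)"
  then obtain m where m: "m \<in> Poly_Mapping.keys (p * q)" "i \<in> Poly_Mapping.keys m"
    by (auto simp: mpoly_vars_def)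
  then obtain k l where "m = k + l" "k \<in> Poly_Mapping.keys p" "l \<in> Poly_Mapping.keys q"
    using keys_mult[of p q] by blast
  with m(2) keys_add[of k l] show "i \<in> mpoly_vars p \<union> mpoly_vars q"
    by (auto simp: mpoly_vars_def)
qed

lemma mpoly_vars_sum: "(\<And>x. x \<in> A \<Longrightarrow> mpoly_vars (p x) \<subseteq> B) \<Longrightarrow> mpoly_vars (sum p A) \<subseteq> B"
proof (induction A rule: infinite_finite_induct)
  case (insert x A)
  then show ?case
    using mpoly_vars_add[of "p x" "sum p A"] by auto
qed auto

lemma mpoly_vars_prod: "(\<And>x. x \<in> A \<Longrightarrow> mpoly_vars (p x) \<subseteq> B) \<Longrightarrow> mpoly_vars (prod p A) \<subseteq> B"
proof (induction A rule: infinite_finite_induct)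
  case (insert x A)
  then show ?case
    using mpoly_vars_mult[of "p x" "prod p A"] by auto
qed auto


section \<open>Arithmetic expressions in polynomials\<close>

text \<open>Used with marginal probabilities for \<open>\<rho>\<close> and polynomial values for
  \<open>\<rho>'\<close>. Agreement is asked only on the atoms that occur in \<open>g\<close>, since
  the two sides are compared only for admissible conjunctions.\<close>

lemma arith_value_map_arith:
  "(\<And>x. x \<in> set_arith g \<Longrightarrow> \<rho> x = \<rho>' (\<phi> x)) \<Longrightarrow>
     arith_value \<rho>' (map_arith \<phi> g) = arith_value \<rho> g"
  by (induction g) auto

lemma arith_defined_map_arith:
  "(\<And>x. x \<in> set_arith g \<Longrightarrow> \<rho> x = \<rho>' (\<phi> x)) \<Longrightarrow>
     arith_defined \<rho>' (map_arith \<phi> g) \<longleftrightarrow> arith_defined \<rho> g"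
  by (induction g) (simp_all add: arith_value_map_arith[of _ \<rho> \<rho>' \<phi>])

text \<open>Structural induction with the usual rules for fractions. The invariant asks that
  \<open>q\<close> does not vanish at points where \<open>h\<close> is defined, rather than
  \<open>q \<noteq> 0\<close>: division by the constant 0 may well produce the zero polynomial as
  denominator.\<close>

lemma arith_polynomial_fraction_where_defined:
  fixes h :: "'i real_mpoly arith"
  assumes "\<And>r. r \<in> set_arith h \<Longrightarrow> mpoly_vars r \<subseteq> B"
  shows "\<exists>p q. mpoly_vars p \<subseteq> B \<and> mpoly_vars q \<subseteq> B \<and>
    (\<forall>\<theta>. arith_defined (mpoly_value \<theta>) h \<longrightarrow> mpoly_value \<theta> q \<noteq> 0 \<and>
       arith_value (mpoly_value \<theta>) h = mpoly_value \<theta> p / mpoly_value \<theta> q)"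
  using assms
proof (induction h)
  case (Constant c)
  show ?case
    \<comment> \<open>The exponent vector 0 makes this the constant polynomial \<open>c\<close>,
      without variables.\<close>
    by (rule exI[of _ "Poly_Mapping.single 0 c"], rule exI[of _ 1])
      (auto simp: mpoly_value_single mpoly_vars_def split: if_splits)
next
  case (Atom r)
  then show ?case
    by (intro exI[of _ r] exI[of _ 1]) auto
next
  case (Add s t)
  obtain p q where s: "mpoly_vars p \<subseteq> B" "mpoly_vars q \<subseteq> B"
    "\<And>\<theta>. arith_defined (mpoly_value \<theta>) s \<Longrightarrow> mpoly_value \<theta> q \<noteq> 0 \<and>
       arith_value (mpoly_value \<theta>) s = mpoly_value \<theta> p / mpoly_value \<theta> q"
    using Add.IH(1) Add.prems by (auto 4 3)
  obtain p' q' where t: "mpoly_vars p' \<subseteq> B" "mpoly_vars q' \<subseteq> B"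
    "\<And>\<theta>. arith_defined (mpoly_value \<theta>) t \<Longrightarrow> mpoly_value \<theta> q' \<noteq> 0 \<and>
       arith_value (mpoly_value \<theta>) t = mpoly_value \<theta> p' / mpoly_value \<theta> q'"
    using Add.IH(2) Add.prems by (auto 4 3)
  have "mpoly_vars (p * q' + p' * q) \<subseteq> B" "mpoly_vars (q * q') \<subseteq> B"
    using s(1,2) t(1,2) mpoly_vars_add[of "p * q'" "p' * q"] mpoly_vars_mult[of p q']
      mpoly_vars_mult[of p' q] mpoly_vars_mult[of q q'] by blast+
  moreover have "mpoly_value \<theta> (q * q') \<noteq> 0 \<and> arith_value (mpoly_value \<theta>) (Add s t) =
      mpoly_value \<theta> (p * q' + p' * q) / mpoly_value \<theta> (q * q')"
    if "arith_defined (mpoly_value \<theta>) (Add s t)" for \<theta>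
    using that s(3)[of \<theta>] t(3)[of \<theta>] by (simp add: add_frac_eq)
  ultimately show ?case
    by blast
next
  case (Subtract s t)
  obtain p q where s: "mpoly_vars p \<subseteq> B" "mpoly_vars q \<subseteq> B"
    "\<And>\<theta>. arith_defined (mpoly_value \<theta>) s \<Longrightarrow> mpoly_value \<theta> q \<noteq> 0 \<and>
       arith_value (mpoly_value \<theta>) s = mpoly_value \<theta> p / mpoly_value \<theta> q"
    using Subtract.IH(1) Subtract.prems by (auto 4 3)
  obtain p' q' where t: "mpoly_vars p' \<subseteq> B" "mpoly_vars q' \<subseteq> B"
    "\<And>\<theta>. arith_defined (mpoly_value \<theta>) t \<Longrightarrow> mpoly_value \<theta> q' \<noteq> 0 \<and>
       arith_value (mpoly_value \<theta>) t = mpoly_value \<theta> p' / mpoly_value \<theta> q'"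
    using Subtract.IH(2) Subtract.prems by (auto 4 3)
  have "mpoly_vars (p * q' - p' * q) \<subseteq> B" "mpoly_vars (q * q') \<subseteq> B"
    using s(1,2) t(1,2) mpoly_vars_diff[of "p * q'" "p' * q"] mpoly_vars_mult[of p q']
      mpoly_vars_mult[of p' q] mpoly_vars_mult[of q q'] by blast+
  moreover have "mpoly_value \<theta> (q * q') \<noteq> 0 \<and> arith_value (mpoly_value \<theta>) (Subtract s t) =
      mpoly_value \<theta> (p * q' - p' * q) / mpoly_value \<theta> (q * q')"
    if "arith_defined (mpoly_value \<theta>) (Subtract s t)" for \<theta>
    using that s(3)[of \<theta>] t(3)[of \<theta>] by (simp add: diff_frac_eq)
  ultimately show ?case
    by blast
next
  case (Multiply s t)
  obtain p q where s: "mpoly_vars p \<subseteq> B" "mpoly_vars q \<subseteq> B"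
    "\<And>\<theta>. arith_defined (mpoly_value \<theta>) s \<Longrightarrow> mpoly_value \<theta> q \<noteq> 0 \<and>
       arith_value (mpoly_value \<theta>) s = mpoly_value \<theta> p / mpoly_value \<theta> q"
    using Multiply.IH(1) Multiply.prems by (auto 4 3)
  obtain p' q' where t: "mpoly_vars p' \<subseteq> B" "mpoly_vars q' \<subseteq> B"
    "\<And>\<theta>. arith_defined (mpoly_value \<theta>) t \<Longrightarrow> mpoly_value \<theta> q' \<noteq> 0 \<and>
       arith_value (mpoly_value \<theta>) t = mpoly_value \<theta> p' / mpoly_value \<theta> q'"
    using Multiply.IH(2) Multiply.prems by (auto 4 3)
  have "mpoly_vars (p * p') \<subseteq> B" "mpoly_vars (q * q') \<subseteq> B"
    using s(1,2) t(1,2) mpoly_vars_mult[of p p'] mpoly_vars_mult[of q q'] by blast+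
  moreover have "mpoly_value \<theta> (q * q') \<noteq> 0 \<and> arith_value (mpoly_value \<theta>) (Multiply s t) =
      mpoly_value \<theta> (p * p') / mpoly_value \<theta> (q * q')"
    if "arith_defined (mpoly_value \<theta>) (Multiply s t)" for \<theta>
    using that s(3)[of \<theta>] t(3)[of \<theta>] by simp
  ultimately show ?case
    by blast
next
  case (Divide s t)
  obtain p q where s: "mpoly_vars p \<subseteq> B" "mpoly_vars q \<subseteq> B"
    "\<And>\<theta>. arith_defined (mpoly_value \<theta>) s \<Longrightarrow> mpoly_value \<theta> q \<noteq> 0 \<and>
       arith_value (mpoly_value \<theta>) s = mpoly_value \<theta> p / mpoly_value \<theta> q"
    using Divide.IH(1) Divide.prems by (auto 4 3)
  obtain p' q' where t: "mpoly_vars p' \<subseteq> B" "mpoly_vars q' \<subseteq> B"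
    "\<And>\<theta>. arith_defined (mpoly_value \<theta>) t \<Longrightarrow> mpoly_value \<theta> q' \<noteq> 0 \<and>
       arith_value (mpoly_value \<theta>) t = mpoly_value \<theta> p' / mpoly_value \<theta> q'"
    using Divide.IH(2) Divide.prems by (auto 4 3)
  have "mpoly_vars (p * q') \<subseteq> B" "mpoly_vars (q * p') \<subseteq> B"
    using s(1,2) t(1,2) mpoly_vars_mult[of p q'] mpoly_vars_mult[of q p'] by blast+
  \<comment> \<open>Definedness of the quotient includes that \<open>t\<close> has a nonzero value,
    so its numerator \<open>p'\<close> is nonzero at \<open>\<theta>\<close> and may enter the
    denominator.\<close>
  moreover have "mpoly_value \<theta> (q * p') \<noteq> 0 \<and> arith_value (mpoly_value \<theta>) (Divide s t) =
      mpoly_value \<theta> (p * q') / mpoly_value \<theta> (q * p')"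
    if "arith_defined (mpoly_value \<theta>) (Divide s t)" for \<theta>
    using that s(3)[of \<theta>] t(3)[of \<theta>] by auto
  ultimately show ?case
    by blast
qed

lemma arith_polynomial_fraction:
  fixes h :: "'i real_mpoly arith"
  assumes "\<And>r. r \<in> set_arith h \<Longrightarrow> mpoly_vars r \<subseteq> B"
  shows "\<exists>p q. q \<noteq> 0 \<and> mpoly_vars p \<subseteq> B \<and> mpoly_vars q \<subseteq> B \<and>
    (\<forall>\<theta>. arith_defined (mpoly_value \<theta>) h \<longrightarrow> mpoly_value \<theta> q \<noteq> 0 \<and>
       arith_value (mpoly_value \<theta>) h = mpoly_value \<theta> p / mpoly_value \<theta> q)"
proof (cases "\<exists>\<theta>. arith_defined (mpoly_value \<theta>) h")
  case True
  \<comment> \<open>At a point of definedness \<open>q\<close> has a nonzero value, which the zero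
    polynomial cannot have.\<close>
  then show ?thesis
    using arith_polynomial_fraction_where_defined[OF assms, of h] by (metis mpoly_value_zero)
next
  case False
  then show ?thesis
    by (intro exI[of _ 0] exI[of _ 1]) simp
qed


section \<open>Marginal probabilities as polynomials\<close>

text \<open>A parent outside \<open>V\<close> lies in \<open>U\<close>, so the recursion reads
  \<open>u\<close> only on \<open>U\<close>. This links the family \<open>X\<close>, given at all
  nodes, to the realizations, which are extensional functions on \<open>U\<close>.\<close>

lemma potential_outcome_restrict:
  assumes "dag_on V U E"
  shows "potential_outcome V E f (restrict u U) a j = potential_outcome V E f u a j"
  using dag_on_wf[OF assms]
proof (induction j rule: wf_induct_rule)
  case (less j)
  have "p \<in> U" if "p \<in> parents E j" "p \<notin> V" for p
    using assms that by (auto simp: dag_on_def parents_def)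
  then have "restrict u U p = u p" if "p \<in> parents E j" "p \<notin> V" for p
    using that by simp
  then show ?case
    using less unfolding potential_outcome_rec[OF assms, of f _ a j]
    by (intro arg_cong[of _ _ "f j"] restrict_ext) (auto simp: parents_def simp del: restrict_apply split: option.splits)
qed

text \<open>Along the edges, each parent receives an admissible value: from the intervention, from
  the induction hypothesis, or from the disturbance.\<close>

lemma potential_outcome_in_values:
  assumes dag: "dag_on V U E" and f: "structural_equations V U E S f"
    and a: "a \<in> interventions V S" and u: "\<And>k. k \<in> U \<Longrightarrow> u k \<in> S k"
  shows "j \<in> V \<Longrightarrow> potential_outcome V E f u a j \<in> S j"
  using dag_on_wf[OF dag]
proof (induction j rule: wf_induct_rule)
  case (less j)
  have "p \<in> V \<union> U" if "p \<in> parents E j" for p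
    using dag that by (auto simp: dag_on_def parents_def)
  then have "p \<in> V \<or> u p \<in> S p" if "p \<in> parents E j" for p
    using that u by blast
  then have "(\<lambda>p\<in>parents E j. case a p of Some y \<Rightarrow> y
      | None \<Rightarrow> (if p \<in> V then potential_outcome V E f u a p else u p)) \<in> (\<Pi>\<^sub>E p\<in>parents E j. S p)"
    using less.IH a by (fastforce simp: interventions_def parents_def split: option.splits)
  moreover have "f j \<in> (\<Pi>\<^sub>E p\<in>parents E j. S p) \<rightarrow> S j"
    using f less.prems by (simp add: structural_equations_def)
  ultimately show ?case
    unfolding potential_outcome_rec[OF dag, of f u a j] by (rule funcset_mem[rotated])
qed

section \<open>Events determined by the disturbances\<close>

text \<open>There are finitely many realizations, so for an arbitrary predicate \<open>Q\<close> the
  event is a finite disjoint union of cells, one for each realization satisfying \<open>Q\<close>.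
  Independence factors the probability of each cell.\<close>

lemma
  assumes fin: "finite U" "\<And>k. k \<in> U \<Longrightarrow> finite (S k)" and X: "disturbance_variables U S M X"
  shows disturbance_event_sets: "{\<omega> \<in> space M. Q (\<lambda>k\<in>U. X k \<omega>)} \<in> sets M"
    and measure_disturbance_event: "measure M {\<omega> \<in> space M. Q (\<lambda>k\<in>U. X k \<omega>)} =
      (\<Sum>u\<in>{u \<in> \<Pi>\<^sub>E k\<in>U. S k. Q u}. \<Prod>k\<in>U. disturbance_law M X (k, u k))"
proof -
  interpret prob_space M
    using X by (simp add: disturbance_variables_def)
  have indep: "indep_vars (\<lambda>k. count_space (S k)) X U"
    using X by (simp add: disturbance_variables_def)
  then have meas: "X k \<in> M \<rightarrow>\<^sub>M count_space (S k)" if "k \<in> U" for k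
    using that by (simp add: indep_vars_def)
  let ?R = "{u \<in> \<Pi>\<^sub>E k\<in>U. S k. Q u}"
  define cell where "cell u = {\<omega> \<in> space M. \<forall>k\<in>U. X k \<omega> = u k}" for u
  have "finite ?R"
    using finite_PiE[of U S] fin by (simp add: Collect_conj_eq)
  \<comment> \<open>The outer \<open>space M\<close> matters when \<open>U\<close> is empty: the
    intersection over no indices is the whole type.\<close>
  have cell_Int: "cell u = space M \<inter> (\<Inter>k\<in>U. X k -` {u k} \<inter> space M)" for u
    by (auto simp: cell_def)
  have cell_sets: "cell u \<in> sets M" if "u \<in> ?R" for u
  proof (cases "U = {}")
    case False
    have "X k -` {u k} \<inter> space M \<in> sets M" if "k \<in> U" for k
      using that \<open>u \<in> ?R\<close> by (intro measurable_sets[OF meas]) auto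
    with fin(1) False have "(\<Inter>k\<in>U. X k -` {u k} \<inter> space M) \<in> sets M"
      by (rule sets.finite_INT)
    then show ?thesis
      unfolding cell_Int by (rule sets.Int[OF sets.top])
  qed (simp add: cell_def)
  have decomposition: "{\<omega> \<in> space M. Q (\<lambda>k\<in>U. X k \<omega>)} = (\<Union>u\<in>?R. cell u)"
  proof (intro equalityI subsetI)
    fix \<omega> assume "\<omega> \<in> {\<omega> \<in> space M. Q (\<lambda>k\<in>U. X k \<omega>)}"
    \<comment> \<open>The cell containing \<open>\<omega>\<close> is that of its own realization,
      restricted to \<open>U\<close>.\<close>
    then show "\<omega> \<in> (\<Union>u\<in>?R. cell u)"
      using measurable_space[OF meas] by (auto simp: cell_def intro!: exI[of _ "\<lambda>k\<in>U. X k \<omega>"])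
  next
    fix \<omega> assume "\<omega> \<in> (\<Union>u\<in>?R. cell u)"
    then obtain u where u: "u \<in> ?R" "\<omega> \<in> cell u" by blast
    \<comment> \<open>Both sides are extensional on \<open>U\<close>, so agreement on
      \<open>U\<close> is equality.\<close>
    then have "(\<lambda>k\<in>U. X k \<omega>) = u"
      by (intro PiE_ext[of _ U "\<lambda>k. S k"]) (auto simp: cell_def PiE_iff)
    with u show "\<omega> \<in> {\<omega> \<in> space M. Q (\<lambda>k\<in>U. X k \<omega>)}"
      by (auto simp: cell_def)
  qed
  have prob_cell: "prob (cell u) = (\<Prod>k\<in>U. disturbance_law M X (k, u k))" if "u \<in> ?R" for u
  \<comment> \<open>The factorization rule requires a nonempty index set. Without disturbances the
    cell is the whole space and the product is empty, so both sides are 1.\<close>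
  proof (cases "U = {}")
    case True
    then show ?thesis by (simp add: cell_def prob_space)
  next
    case False
    then have "cell u = (\<Inter>k\<in>U. X k -` {u k} \<inter> space M)"
      unfolding cell_Int by auto
    moreover have "{u k} \<in> sets (count_space (S k))" if "k \<in> U" for k
      using that \<open>u \<in> ?R\<close> by auto
    ultimately have "prob (cell u) = (\<Prod>k\<in>U. prob (X k -` {u k} \<inter> space M))"
      using indep_varsD_finite[OF indep False fin(1)] by (simp only:)
    also have "\<dots> = (\<Prod>k\<in>U. disturbance_law M X (k, u k))"
      by (intro prod.cong) (auto simp: disturbance_law_def intro!: arg_cong[of _ _ prob])
    finally show ?thesis .
  qed
  have disjoint: "disjoint_family_on cell ?R"
  proof (unfold disjoint_family_on_def, intro ballI impI)
    fix u u' assume "u \<in> ?R" "u' \<in> ?R" "u \<noteq> u'"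
    then obtain k where "k \<in> U" "u k \<noteq> u' k"
      by (metis (mono_tags, lifting) PiE_ext mem_Collect_eq)
    then show "cell u \<inter> cell u' = {}"
      by (auto simp: cell_def)
  qed
  show "{\<omega> \<in> space M. Q (\<lambda>k\<in>U. X k \<omega>)} \<in> sets M"
    unfolding decomposition using cell_sets \<open>finite ?R\<close> by blast
  show "measure M {\<omega> \<in> space M. Q (\<lambda>k\<in>U. X k \<omega>)} =
      (\<Sum>u\<in>?R. \<Prod>k\<in>U. disturbance_law M X (k, u k))"
    unfolding decomposition using cell_sets \<open>finite ?R\<close> disjoint
    by (subst finite_measure_finite_Union) (auto simp: prob_cell)
qed

text \<open>The full data law is an image measure. Pulling the conjunction back to the sample space
  gives an event determined by the disturbances, whose probability is already known.\<close>

lemma marginal_prob_eq_mpoly_value: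
  assumes dag: "dag_on V U E" and f: "structural_equations V U E S f"
    and C: "C \<in> counterfactual_conjunctions V S" and X: "disturbance_variables U S M X"
  shows "marginal_prob (full_data_law V E S f M X) C =
    mpoly_value (disturbance_law M X) (marginal_polynomial V U E S f C)"
proof -
  let ?Y = "\<lambda>\<omega> j a. potential_outcome V E f (\<lambda>k. X k \<omega>) a j"
  let ?Z = "\<lambda>\<omega>. \<lambda>(j, a)\<in>V \<times> interventions V S. ?Y \<omega> j a"
  let ?N = "\<Pi>\<^sub>M (j, a)\<in>V \<times> interventions V S. count_space (S j)"
  let ?B = "{y \<in> space ?N. \<forall>(j, a, v)\<in>C. y (j, a) = v}"
  interpret prob_space M
    using X by (simp add: disturbance_variables_def)
  have fin: "finite (S x)" if "x \<in> V \<union> U" for x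
    using f that by (simp add: structural_equations_def)
  have finU: "finite U"
    using dag by (simp add: dag_on_def)
  note restrict = potential_outcome_restrict[OF dag, of f, symmetric]
  have XS: "X k \<omega> \<in> S k" if "k \<in> U" "\<omega> \<in> space M" for k \<omega>
    using X that measurable_space[of "X k" M "count_space (S k)" \<omega>]
    by (auto simp: disturbance_variables_def indep_vars_def)
  \<comment> \<open>As \<open>S j\<close> is finite, preimages of single values suffice, and each of
    them is determined by the disturbances.\<close>
  have outcome_measurable: "(\<lambda>\<omega>. ?Y \<omega> j a) \<in> M \<rightarrow>\<^sub>M count_space (S j)"
    if "j \<in> V" "a \<in> interventions V S" for j a
  proof (subst measurable_count_space_eq_countable)
    show "countable (S j)"
      using fin that by (auto intro: countable_finite)
    have "(\<lambda>\<omega>. ?Y \<omega> j a) -` {v} \<inter> space M =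
        {\<omega> \<in> space M. potential_outcome V E f (\<lambda>k\<in>U. X k \<omega>) a j = v}" for v
      by (auto simp: restrict[of "\<lambda>k. X k _"])
    then have "(\<lambda>\<omega>. ?Y \<omega> j a) -` {v} \<inter> space M \<in> sets M" for v
      using disturbance_event_sets[OF finU _ X, of "\<lambda>u. potential_outcome V E f u a j = v"] fin
      by simp
    then show "(\<lambda>\<omega>. ?Y \<omega> j a) \<in> space M \<rightarrow> S j \<and>
        (\<forall>v\<in>S j. (\<lambda>\<omega>. ?Y \<omega> j a) -` {v} \<inter> space M \<in> sets M)"
      using potential_outcome_in_values[OF dag f that(2) _ that(1)] XS by auto
  qed
  have Z: "?Z \<in> M \<rightarrow>\<^sub>M ?N"
    by (intro measurable_restrict) (auto intro: outcome_measurable)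
  \<comment> \<open>A finite intersection of one-coordinate events; the leading
    \<open>space ?N\<close> covers the empty conjunction.\<close>
  have "?B = space ?N \<inter> (\<Inter>(j, a, v)\<in>C. {y \<in> space ?N. y (j, a) = v})"
    by auto
  also have "\<dots> \<in> sets ?N"
  proof (cases "C = {}")
    case False
    have "{y \<in> space ?N. y (j, a) = v} \<in> sets ?N" if "(j, a, v) \<in> C" for j a v
    proof -
      have "(\<lambda>y. y (j, a)) \<in> ?N \<rightarrow>\<^sub>M count_space (S j)"
        using C that measurable_component_singleton[of "(j, a)" "V \<times> interventions V S"
            "\<lambda>(j, a). count_space (S j)"]
        by (auto simp: counterfactual_conjunctions_def)
      from measurable_sets[OF this, of "{v}"] show ?thesis
        using C that by (auto simp: counterfactual_conjunctions_def vimage_def Int_def conj_commute)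
    qed
    then show ?thesis
      using C False by (intro sets.Int sets.finite_INT)
        (auto simp: counterfactual_conjunctions_def)
  qed auto
  finally have B: "?B \<in> sets ?N" .
  have "marginal_prob (full_data_law V E S f M X) C = measure M (?Z -` ?B \<inter> space M)"
    unfolding marginal_prob_def full_data_law_def space_distr by (rule measure_distr[OF Z B])
  \<comment> \<open>Every pair \<open>(j, a)\<close> in \<open>C\<close> is an index of the product,
    so the coordinate there is the potential outcome itself and not the default value.\<close>
  also have "?Z -` ?B \<inter> space M =
      {\<omega> \<in> space M. \<forall>(j, a, v)\<in>C. potential_outcome V E f (\<lambda>k\<in>U. X k \<omega>) a j = v}"
    using C measurable_space[OF Z]
    by (fastforce simp: counterfactual_conjunctions_def restrict[of "\<lambda>k. X k _"])
  also have "measure M \<dots> = (\<Sum>u\<in>satisfying_realizations V U E S f C.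
      \<Prod>k\<in>U. disturbance_law M X (k, u k))"
    unfolding satisfying_realizations_def
    using fin by (intro measure_disturbance_event[OF finU _ X]) auto
  finally show ?thesis
    by (simp add: marginal_polynomial_def)
qed

lemma mpoly_vars_marginal_polynomial: "mpoly_vars (marginal_polynomial V U E S f C) \<subseteq> Sigma U S"
  unfolding marginal_polynomial_def
  by (intro mpoly_vars_sum mpoly_vars_prod) (auto simp: satisfying_realizations_def)

text \<open>The polynomials \<open>p\<close> and \<open>q\<close> are chosen before \<open>M\<close>
  and \<open>X\<close>, so one fraction serves all laws of the disturbances. The identity for
  \<open>h\<close> holds at every real \<open>\<theta>\<close> where \<open>h\<close> is defined,
  not only at probability vectors.\<close>

theorem corollary1:
  fixes V U :: "'n set" and E :: "'n rel" and S :: "'n \<Rightarrow> 'a set"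
    and f :: "'n \<Rightarrow> ('n \<Rightarrow> 'a) \<Rightarrow> 'a"
    and g :: "('n, 'a) statements arith"
    and h :: "('n \<times> 'a) real_mpoly arith"
  assumes "canonical_dag V U E"
    and "structural_equations V U E S f"
    and "set_arith g \<subseteq> counterfactual_conjunctions V S"
    and "h = map_arith (marginal_polynomial V U E S f) g"
  shows "\<exists>p q :: ('n \<times> 'a) real_mpoly.
    q \<noteq> 0 \<and>
    mpoly_vars p \<subseteq> Sigma U S \<and> mpoly_vars q \<subseteq> Sigma U S \<and>
    (\<forall>\<theta>. arith_defined (mpoly_value \<theta>) h \<longrightarrow>
       mpoly_value \<theta> q \<noteq> 0 \<and>
       arith_value (mpoly_value \<theta>) h = mpoly_value \<theta> p / mpoly_value \<theta> q) \<and>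
    (\<forall>(M :: 'w measure) X. disturbance_variables U S M X \<longrightarrow>
       arith_defined (marginal_prob (full_data_law V E S f M X)) g \<longrightarrow>
         arith_defined (mpoly_value (disturbance_law M X)) h \<and>
         mpoly_value (disturbance_law M X) q \<noteq> 0 \<and>
         arith_value (marginal_prob (full_data_law V E S f M X)) g =
           mpoly_value (disturbance_law M X) p / mpoly_value (disturbance_law M X) q)"
proof -
  have dag: "dag_on V U E"
    using assms(1) by (simp add: canonical_dag_def)
  have "mpoly_vars r \<subseteq> Sigma U S" if "r \<in> set_arith h" for r
    using that mpoly_vars_marginal_polynomial unfolding assms(4) arith.set_map by blast
  from arith_polynomial_fraction[OF this] obtain p q where pq:
    "q \<noteq> 0" "mpoly_vars p \<subseteq> Sigma U S" "mpoly_vars q \<subseteq> Sigma U S"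
    "\<forall>\<theta>. arith_defined (mpoly_value \<theta>) h \<longrightarrow> mpoly_value \<theta> q \<noteq> 0 \<and>
       arith_value (mpoly_value \<theta>) h = mpoly_value \<theta> p / mpoly_value \<theta> q"
    by blast
  \<comment> \<open>At the parameters of an actual law, the atoms of \<open>g\<close> and the
    polynomials replacing them have equal values. Hence definedness of \<open>g\<close> passes to
    \<open>h\<close>, and the fraction can be evaluated at this \<open>\<theta>\<close>.\<close>
  have "arith_value (mpoly_value (disturbance_law M X)) h =
        arith_value (marginal_prob (full_data_law V E S f M X)) g"
      "arith_defined (mpoly_value (disturbance_law M X)) h \<longleftrightarrow>
        arith_defined (marginal_prob (full_data_law V E S f M X)) g"
    if "disturbance_variables U S M X" for M :: "'w measure" and X
    unfolding assms(4)
    using marginal_prob_eq_mpoly_value[OF dag assms(2) _ that] assms(3)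
    by (auto intro!: arith_value_map_arith arith_defined_map_arith)
  with pq show ?thesis
    by (intro exI[of _ p] exI[of _ q]) metis
qed

end
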